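(* Let $\mathcal{L}$ be a finite meet-semilattice and let $$B^{\bullet}(\mathcal{L}) = \frac{\mathbb{Z}[h_x]_{x \in \mathcal{L}}}{((h_x - h_{x \wedge y})(h_y - h_{x \wedge y}) : x, y \in \mathcal{L})},$$ graded with each $h_x$ in degree $1$. Then $B^{\bullet}(\mathcal{L})$ is an algebra with straightening law over $\mathcal{L}$ (via $x \mapsto h_x$).
   Context: A finite meet-semilattice is a finite poset in which any two elements $x, y$ have a greatest lower bound $x \wedge y$; it has a minimal element $\hat{0}$. Let $B^{\bullet}$ be a graded algebra over a ring $R$ with $B^0 = R$, and $(\Pi, \le)$ a finite poset with an injection identifying $\Pi$ with a subset of $B^{\bullet}$ consisting of homogeneous elements of positive degree. $B^{\bullet}$ is an algebra with straightening law over $\Pi$ if (1) the standard monomials $\{y_1^{a_1} \dotsb y_k^{a_k} : y_1 \le \dotsb \le y_k \in \Pi\}$ form an $R$-basis of $B^{\bullet}$, and (2) for all incomparable $x, y \in \Pi$, when $xy = \sum a_\mu \mu$ is written in the standard monomial basis, every standard monomial $\mu$ with $a_\mu \neq 0$ contains a factor $z \in \Pi$ with $z < x$ and $z < y$. Here $R = \mathbb{Z}$. *)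

theory Defs
  imports "HOL-Algebra.Algebra" "HOL-Algebra.Algebraic_Closure_Type"
    "HOL-Library.Poly_Mapping" "HOL-Library.Multiset"
begin

section \<open>Bases of modules and graded algebras\<close>

definition coeffs_on :: "('r, 'm) ring_scheme \<Rightarrow> 'i set \<Rightarrow> ('i \<Rightarrow> 'r) set" where
  "coeffs_on R S = {c. (\<forall>i. c i \<in> carrier R) \<and> (\<forall>i. i \<notin> S \<longrightarrow> c i = \<zero>\<^bsub>R\<^esub>) \<and> finite {i. c i \<noteq> \<zero>\<^bsub>R\<^esub>}}"

definition lin_comb ::
  "('r, 'm) ring_scheme \<Rightarrow> ('r, 'b, 'n) module_scheme \<Rightarrow> ('i \<Rightarrow> 'b) \<Rightarrow> ('i \<Rightarrow> 'r) \<Rightarrow> 'b" where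
  "lin_comb R B v c = (\<Oplus>\<^bsub>B\<^esub>i \<in> {i. c i \<noteq> \<zero>\<^bsub>R\<^esub>}. c i \<odot>\<^bsub>B\<^esub> v i)"

text \<open>A basis is an indexed family, so distinct indices in \<open>S\<close> carry distinct vectors
  (over a nonzero ring).\<close>

definition is_basis ::
  "('r, 'm) ring_scheme \<Rightarrow> ('r, 'b, 'n) module_scheme \<Rightarrow> ('i \<Rightarrow> 'b) \<Rightarrow> 'i set \<Rightarrow> bool" where
  "is_basis R B v S \<longleftrightarrow>
     (\<forall>i\<in>S. v i \<in> carrier B) \<and>
     (\<forall>c\<in>coeffs_on R S. lin_comb R B v c = \<zero>\<^bsub>B\<^esub> \<longrightarrow> (\<forall>i\<in>S. c i = \<zero>\<^bsub>R\<^esub>)) \<and>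
     (\<forall>b\<in>carrier B. \<exists>c\<in>coeffs_on R S. b = lin_comb R B v c)"

text \<open>Here \<open>B\<close> is the internal direct sum of its homogeneous components \<open>grade n\<close>.\<close>

locale graded_algebra = algebra R B
  for R :: "('r, 'm) ring_scheme" and B :: "('r, 'b, 'n) module_scheme" +
  fixes grade :: "nat \<Rightarrow> 'b set"
  assumes grade_submodule: "submodule (grade n) R B"
    and grade_direct_sum:
      "b \<in> carrier B \<Longrightarrow>
         \<exists>!f. (\<forall>n. f n \<in> grade n) \<and> finite {n. f n \<noteq> \<zero>\<^bsub>B\<^esub>} \<and>
              b = (\<Oplus>\<^bsub>B\<^esub>n \<in> {n. f n \<noteq> \<zero>\<^bsub>B\<^esub>}. f n)"
    and one_in_grade_0: "\<one>\<^bsub>B\<^esub> \<in> grade 0"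
    and grade_mult: "\<lbrakk>a \<in> grade i; b \<in> grade j\<rbrakk> \<Longrightarrow> a \<otimes>\<^bsub>B\<^esub> b \<in> grade (i + j)"


section \<open>Algebras with straightening law\<close>

text \<open>A monomial \<open>y\<^sub>1\<^bsup>a\<^sub>1\<^esup> \<cdots> y\<^sub>k\<^bsup>a\<^sub>k\<^esup>\<close> is encoded by the multiset
  in which each \<open>y\<^sub>i\<close> occurs \<open>a\<^sub>i\<close> times; it contains the factor \<open>z\<close> iff \<open>z \<in># M\<close>.\<close>

definition monomial_val :: "('b, 'n) ring_scheme \<Rightarrow> ('p \<Rightarrow> 'b) \<Rightarrow> 'p multiset \<Rightarrow> 'b" where
  "monomial_val B \<iota> M = (\<Otimes>\<^bsub>B\<^esub>y \<in> set_mset M. \<iota> y [^]\<^bsub>B\<^esub> count M y)"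

definition standard_monomials :: "'p::order multiset set" where
  "standard_monomials = {M. \<forall>x\<in>#M. \<forall>y\<in>#M. x \<le> y \<or> y \<le> x}"

locale algebra_with_straightening_law = graded_algebra R B grade
  for R :: "('r, 'm) ring_scheme" and B :: "('r, 'b, 'n) module_scheme" and grade +
  fixes \<iota> :: "'p::{finite,order} \<Rightarrow> 'b"
  assumes grade_0: "bij_betw (\<lambda>r. r \<odot>\<^bsub>B\<^esub> \<one>\<^bsub>B\<^esub>) (carrier R) (grade 0)"
    and inj_generators: "inj \<iota>"
    and generators_homogeneous: "\<exists>n>0. \<iota> x \<in> grade n"
    and standard_basis: "is_basis R B (monomial_val B \<iota>) standard_monomials"
    and straightening:
      "\<lbrakk>\<not> x \<le> y; \<not> y \<le> x; c \<in> coeffs_on R standard_monomials;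
        \<iota> x \<otimes>\<^bsub>B\<^esub> \<iota> y = lin_comb R B (monomial_val B \<iota>) c; c M \<noteq> \<zero>\<^bsub>R\<^esub>\<rbrakk>
       \<Longrightarrow> \<exists>z. z \<in># M \<and> z < x \<and> z < y"


section \<open>The algebra of a finite meet-semilattice\<close>

text \<open>\<open>\<int>[h\<^sub>x]\<close> is the monoid algebra over \<open>\<int>\<close> of the free commutative monoid on the variables:
  finitely supported functions from multisets (monomials) to integer coefficients, with
  convolution product.\<close>

type_synonym 'a int_mpoly = "'a multiset \<Rightarrow>\<^sub>0 int"

definition hvar :: "'a \<Rightarrow> 'a int_mpoly" where
  "hvar x = Poly_Mapping.single {#x#} 1"

definition homogeneous_poly :: "nat \<Rightarrow> 'a int_mpoly \<Rightarrow> bool" where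
  "homogeneous_poly n f \<longleftrightarrow> (\<forall>m\<in>Poly_Mapping.keys f. size m = n)"

abbreviation int_mpoly_ring :: "'a int_mpoly ring" where
  "int_mpoly_ring \<equiv> ring_of_type_algebra"

definition relation_ideal :: "'a::{finite,semilattice_inf} int_mpoly set" where
  "relation_ideal =
     Idl\<^bsub>int_mpoly_ring\<^esub>
       {(hvar x - hvar (inf x y)) * (hvar y - hvar (inf x y)) |x y. True}"

text \<open>A ring is a \<open>\<int>\<close>-algebra through integer multiples.\<close>

definition int_algebra_of :: "'b ring \<Rightarrow> (int, 'b) module" where
  "int_algebra_of Q = ring.extend Q \<lparr>module.smult = (\<lambda>k b. add_pow Q k b)\<rparr>"

definition semilattice_algebra :: "(int, 'a::{finite,semilattice_inf} int_mpoly set) module" where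
  "semilattice_algebra = int_algebra_of (int_mpoly_ring Quot relation_ideal)"

definition poly_class :: "'a::{finite,semilattice_inf} int_mpoly \<Rightarrow> 'a int_mpoly set" where
  "poly_class f = relation_ideal +>\<^bsub>int_mpoly_ring\<^esub> f"

definition semilattice_grade :: "nat \<Rightarrow> 'a::{finite,semilattice_inf} int_mpoly set set" where
  "semilattice_grade n = poly_class ` {f. homogeneous_poly n f}"

end

theory Submission
  imports Defs
begin

text \<open>
  For incomparable \<open>x\<close>, \<open>y\<close> with meet \<open>z\<close> the defining relation reads
  \<open>h\<^sub>x h\<^sub>y = h\<^sub>z h\<^sub>x + h\<^sub>z h\<^sub>y - h\<^sub>z\<^sup>2\<close>. Rewriting from left to right preserves the degree and lowers the
  total height of a monomial, so standard monomials span.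

  For independence, let \<open>C\<close> be a chain and let \<open>\<pi> x\<close> be the largest element of \<open>C \<union> {0}\<close> below
  \<open>x\<close>. Since \<open>\<pi> (x \<sqinter> y)\<close> is the smaller of \<open>\<pi> x\<close> and \<open>\<pi> y\<close>, the substitution \<open>h\<^sub>x \<mapsto> h\<^bsub>\<pi> x\<^esub>\<close>
  kills every relation. Given a standard combination in the ideal, take \<open>C\<close> to be the support of a
  monomial \<open>M\<close> of maximal total height among those occurring. As \<open>\<pi>\<close> lowers heights and fixes
  \<open>C\<close>, only \<open>M\<close> itself is mapped to \<open>M\<close>, so its coefficient vanishes.

  The grading is direct because a homogeneous polynomial is congruent to a standard one of the
  same degree.
\<close>

section \<open>Standard monomials modulo the relations\<close>

text \<open>The last conclusion is stated as a disjunction because this is exactly what makes one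
  factor of a defining relation vanish after the substitution along \<open>\<pi>\<close>.\<close>

lemma finite_chain_retraction:
  fixes C :: "'a::{finite,semilattice_inf} set"
  assumes chain: "\<And>x y. x \<in> C \<Longrightarrow> y \<in> C \<Longrightarrow> x \<le> y \<or> y \<le> x"
  obtains \<pi> :: "'a \<Rightarrow> 'a" where "\<And>x. \<pi> x \<le> x" "\<And>c. c \<in> C \<Longrightarrow> \<pi> c = c"
    "\<And>x y. \<pi> (inf x y) = \<pi> x \<or> \<pi> (inf x y) = \<pi> y"
proof -
  \<comment> \<open>\<open>Inf_fin UNIV\<close> is the bottom element. Adjoining it keeps the set a
    chain and puts at least one element of \<open>D\<close> below every \<open>x\<close>, even for
    empty \<open>C\<close>.\<close>
  define D where "D = insert (Inf_fin UNIV) C"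
  have bottom: "Inf_fin UNIV \<le> x" for x :: 'a
    by (simp add: Inf_fin.coboundedI)
  have chain_D: "x \<le> y \<or> y \<le> x" if "x \<in> D" "y \<in> D" for x y
    using that chain bottom by (auto simp: D_def)
  have "\<exists>m\<in>D. m \<le> x \<and> (\<forall>c\<in>D. c \<le> x \<longrightarrow> c \<le> m)" for x
  proof -
    have "finite {c \<in> D. c \<le> x}" "{c \<in> D. c \<le> x} \<noteq> {}"
      using bottom by (auto simp: D_def)
    from finite_has_maximal[OF this] obtain m where "m \<in> D" "m \<le> x"
      "\<And>c. c \<in> D \<Longrightarrow> c \<le> x \<Longrightarrow> m \<le> c \<Longrightarrow> c = m" by auto
    then show ?thesis using chain_D by metis
  qed
  then obtain \<pi> where \<pi>: "\<And>x. \<pi> x \<in> D" "\<And>x. \<pi> x \<le> x"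
    "\<And>x c. c \<in> D \<Longrightarrow> c \<le> x \<Longrightarrow> c \<le> \<pi> x" by metis
  show thesis
  proof
    show "\<pi> x \<le> x" for x by (rule \<pi>)
    show "\<pi> c = c" if "c \<in> C" for c
      using that by (intro antisym \<pi>) (auto simp: D_def)
    \<comment> \<open>If \<open>\<pi> x \<le> \<pi> y\<close>, then \<open>\<pi> x\<close> is an
      element of \<open>D\<close> below both \<open>x\<close> and \<open>y\<close>, hence below
      their meet. The other case follows by symmetry, since \<open>D\<close> is a chain.\<close>
    have inf_eq: "\<pi> (inf x y) = \<pi> x" if "\<pi> x \<le> \<pi> y" for x y
    proof (rule antisym)
      show "\<pi> (inf x y) \<le> \<pi> x"
        by (rule \<pi>(3)[OF \<pi>(1)]) (use \<pi>(2)[of "inf x y"] in simp)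
      show "\<pi> x \<le> \<pi> (inf x y)"
        by (rule \<pi>(3)[OF \<pi>(1)]) (use \<pi>(2)[of x] \<pi>(2)[of y] that in auto)
    qed
    show "\<pi> (inf x y) = \<pi> x \<or> \<pi> (inf x y) = \<pi> y" for x y
      using chain_D[OF \<pi>(1) \<pi>(1), of x y] inf_eq[of x y] inf_eq[of y x] by (auto simp: inf.commute)
  qed
qed

section \<open>Heights of elements and weights of monomials\<close>

text \<open>Only strict monotonicity is used below; counting the elements strictly below
  \<open>x\<close> provides it in every finite order.\<close>

definition height :: "'a::{finite,order} \<Rightarrow> nat" where
  "height x = card {w. w < x}"

lemma height_less: "height x < height y" if "x < y"
  unfolding height_def using that by (intro psubset_card_mono) auto

definition weight :: "'a::{finite,order} multiset \<Rightarrow> nat" where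
  "weight M = (\<Sum>x\<in>#M. height x)"

text \<open>The inequality holds term by term. Equality of the totals forces equality of every term,
  and a strict descent \<open>\<pi> x < x\<close> would lower the height.\<close>

lemma weight_image_le:
  fixes \<pi> :: "'a::{finite,order} \<Rightarrow> 'a"
  assumes "\<And>x. \<pi> x \<le> x"
  shows "weight (image_mset \<pi> M) \<le> weight M"
    and "weight (image_mset \<pi> M) = weight M \<Longrightarrow> image_mset \<pi> M = M"
proof -
  have h: "height (\<pi> x) \<le> height x" "height (\<pi> x) = height x \<Longrightarrow> \<pi> x = x" for x
    using height_less[of "\<pi> x" x] assms[of x] by (cases "\<pi> x = x"; simp add: order_less_le)+
  have "weight (image_mset \<pi> M) \<le> weight M \<and>
    (weight (image_mset \<pi> M) = weight M \<longrightarrow> image_mset \<pi> M = M)"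
  proof (induction M)
    case (add x M)
    then show ?case using h[of x] by (auto simp: weight_def)
  qed (auto simp: weight_def)
  then show "weight (image_mset \<pi> M) \<le> weight M"
    and "weight (image_mset \<pi> M) = weight M \<Longrightarrow> image_mset \<pi> M = M" by auto
qed

section \<open>The polynomial ring and the ideal of relations\<close>

lemma cring_int_mpoly: "cring (int_mpoly_ring :: 'a int_mpoly ring)"
  by (rule cring_from_type_algebra)

lemma int_mpoly_ring_simps [simp]:
  "carrier (int_mpoly_ring :: 'a int_mpoly ring) = UNIV"
  "f \<otimes>\<^bsub>int_mpoly_ring\<^esub> g = f * g" "f \<oplus>\<^bsub>int_mpoly_ring\<^esub> g = f + g"
  "\<one>\<^bsub>int_mpoly_ring\<^esub> = (1 :: 'a int_mpoly)" "\<zero>\<^bsub>int_mpoly_ring\<^esub> = (0 :: 'a int_mpoly)"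
  by (auto simp: ring_of_type_algebra_def)

lemma int_mpoly_ring_a_inv [simp]: "\<ominus>\<^bsub>int_mpoly_ring\<^esub> f = - (f :: 'a int_mpoly)"
proof -
  interpret cring "int_mpoly_ring :: 'a int_mpoly ring" by (rule cring_int_mpoly)
  show ?thesis by (rule minus_equality) auto
qed

lemma ideal_relation_ideal:
  "ideal (relation_ideal :: 'a::{finite,semilattice_inf} int_mpoly set) int_mpoly_ring"
  unfolding relation_ideal_def
  by (rule ring.genideal_ideal) (auto intro: cring.axioms cring_int_mpoly)

lemma relation_ideal_zero: "0 \<in> relation_ideal"
  using additive_subgroup.zero_closed[OF ideal.axioms(1)[OF ideal_relation_ideal]] by simp

lemma relation_ideal_add: "f \<in> relation_ideal \<Longrightarrow> g \<in> relation_ideal \<Longrightarrow> f + g \<in> relation_ideal"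
  using additive_subgroup.a_closed[OF ideal.axioms(1)[OF ideal_relation_ideal]] by simp

lemma relation_ideal_mult: "f \<in> relation_ideal \<Longrightarrow> g * f \<in> relation_ideal"
  using ideal.I_l_closed[OF ideal_relation_ideal, of f g] by simp

lemma relation_ideal_diff: "f \<in> relation_ideal \<Longrightarrow> g \<in> relation_ideal \<Longrightarrow> f - g \<in> relation_ideal"
  using relation_ideal_add[of f "-1 * g"] relation_ideal_mult[of g "-1"] by simp

lemma relation_in_ideal:
  "(hvar x - hvar (inf x y)) * (hvar y - hvar (inf x y)) \<in> relation_ideal"
proof -
  interpret cring "int_mpoly_ring :: 'a int_mpoly ring" by (rule cring_int_mpoly)
  show ?thesis
    unfolding relation_ideal_def
    using genideal_self[of "{(hvar x - hvar (inf x y)) * (hvar y - hvar (inf x y)) |x y. True}"] by auto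
qed

section \<open>Substitution of variables and linear independence\<close>

text \<open>The additive group of polynomials is the free abelian group on the multisets, with
  \<open>frag_of M\<close> the monomial \<open>M\<close>. Extending from generators gives additivity
  at once; multiplicativity has to be proved.\<close>

definition map_vars :: "('a \<Rightarrow> 'b) \<Rightarrow> 'a int_mpoly \<Rightarrow> 'b int_mpoly" where
  "map_vars \<pi> = frag_extend (\<lambda>M. frag_of (image_mset \<pi> M))"

lemma map_vars_simps [simp]:
  "map_vars \<pi> 0 = 0"
  "map_vars \<pi> (frag_of M) = frag_of (image_mset \<pi> M)"
  "map_vars \<pi> (f + g) = map_vars \<pi> f + map_vars \<pi> g"
  "map_vars \<pi> (f - g) = map_vars \<pi> f - map_vars \<pi> g"
  "map_vars \<pi> (hvar x) = hvar (\<pi> x)"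
  by (simp_all add: map_vars_def frag_extend_add frag_extend_diff hvar_def)

text \<open>Both sides are biadditive, so it is enough to compare them on two monomials, where the
  product is the sum of multisets.\<close>

lemma map_vars_mult [simp]: "map_vars \<pi> (f * g) = map_vars \<pi> f * map_vars \<pi> g"
proof (induction f rule: frag_induction[OF subset_UNIV])
  case (2 M)
  show ?case
    by (induction g rule: frag_induction[OF subset_UNIV])
      (auto simp: mult_single algebra_simps)
qed (auto simp: algebra_simps)

text \<open>The kernel of the substitution is an ideal, and it contains every generator because
  \<open>hvar (\<pi> (inf x y))\<close> cancels against \<open>hvar (\<pi> x)\<close> or
  \<open>hvar (\<pi> y)\<close> in one of the two factors.\<close>

lemma map_vars_relation_ideal:
  fixes \<pi> :: "'a::{finite,semilattice_inf} \<Rightarrow> 'b"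
  assumes "\<And>x y. \<pi> (inf x y) = \<pi> x \<or> \<pi> (inf x y) = \<pi> y" "f \<in> relation_ideal"
  shows "map_vars \<pi> f = 0"
proof -
  interpret cring "int_mpoly_ring :: 'a int_mpoly ring" by (rule cring_int_mpoly)
  have "ideal {f. map_vars \<pi> f = 0} int_mpoly_ring"
  proof (intro idealI ring_axioms)
    show "subgroup {f. map_vars \<pi> f = 0} (add_monoid int_mpoly_ring)"
    proof
      fix f :: "'a int_mpoly" assume "f \<in> {f. map_vars \<pi> f = 0}"
      then show "inv\<^bsub>add_monoid int_mpoly_ring\<^esub> f \<in> {f. map_vars \<pi> f = 0}"
        using map_vars_simps(4)[of \<pi> 0 f] int_mpoly_ring_a_inv[of f, unfolded a_inv_def] by simp
    qed auto
  qed auto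
  moreover have "map_vars \<pi> ((hvar x - hvar (inf x y)) * (hvar y - hvar (inf x y))) = 0" for x y
    using assms(1)[of x y] by auto
  ultimately have "relation_ideal \<subseteq> {f. map_vars \<pi> f = 0}"
    unfolding relation_ideal_def by (intro genideal_minimal) auto
  then show ?thesis using assms(2) by auto
qed

lemma standard_in_relation_ideal:
  fixes f :: "'a::{finite,semilattice_inf} int_mpoly"
  assumes "f \<in> relation_ideal" and std: "Poly_Mapping.keys f \<subseteq> standard_monomials"
  shows "f = 0"
proof (rule ccontr)
  assume "f \<noteq> 0"
  then have fin: "finite (weight ` Poly_Mapping.keys f)" "weight ` Poly_Mapping.keys f \<noteq> {}" by auto
  obtain M where M: "M \<in> Poly_Mapping.keys f" "weight M = Max (weight ` Poly_Mapping.keys f)"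
    using Max_in[OF fin] by (auto simp: image_iff)
  then have max: "weight N \<le> weight M" if "N \<in> Poly_Mapping.keys f" for N
    using that fin by simp
  obtain \<pi> where \<pi>: "\<And>x. \<pi> x \<le> x" "\<And>c. c \<in># M \<Longrightarrow> \<pi> c = c"
    "\<And>x y. \<pi> (inf x y) = \<pi> x \<or> \<pi> (inf x y) = \<pi> y"
    by (rule finite_chain_retraction[of "set_mset M"])
      (use M(1) std in \<open>auto simp: standard_monomials_def\<close>)
  have fix_M: "image_mset \<pi> M = M"
    using \<pi>(2) by (rule multiset.map_ident_strong)
  \<comment> \<open>If \<open>N\<close> is sent to \<open>M\<close>, then
    \<open>weight M \<le> weight N\<close>. Maximality turns this into an equality, which forces
    \<open>image_mset \<pi> N = N\<close>.\<close>
  have img: "image_mset \<pi> N = M \<longleftrightarrow> N = M" if "N \<in> Poly_Mapping.keys f" for N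
    using weight_image_le[of \<pi> N, OF \<pi>(1)] max[OF that] fix_M by auto
  \<comment> \<open>The coefficient of \<open>M\<close> in the image collects the coefficients of
    all \<open>N\<close> sent to \<open>M\<close>, so it is just the coefficient of \<open>M\<close>
    in \<open>f\<close>. The image itself is zero.\<close>
  have "Poly_Mapping.lookup (map_vars \<pi> f) M =
    (\<Sum>N\<in>Poly_Mapping.keys f. if N = M then Poly_Mapping.lookup f N else 0)"
    unfolding map_vars_def frag_extend_def lookup_sum
    by (intro sum.cong) (use img in \<open>auto dest: sym\<close>)
  then have "Poly_Mapping.lookup f M = 0"
    using M(1) map_vars_relation_ideal[OF \<pi>(3) assms(1)] by simp
  then show False using M(1) by (simp add: in_keys_iff)
qed

section \<open>Straightening and spanning\<close>

lemma monomial_straightening: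
  fixes M :: "'a::{finite,semilattice_inf} multiset"
  shows "\<exists>g. Poly_Mapping.keys g \<subseteq> {N \<in> standard_monomials. size N = size M} \<and>
    frag_of M - g \<in> relation_ideal"
proof (induction M rule: measure_induct_rule[of weight])
  case (less M)
  show ?case
  proof (cases "M \<in> standard_monomials")
    case True
    then show ?thesis by (intro exI[of _ "frag_of M"]) (auto simp: relation_ideal_zero)
  next
    case False
    then obtain x y where xy: "x \<in># M" "y \<in># M" "\<not> x \<le> y" "\<not> y \<le> x"
      by (auto simp: standard_monomials_def)
    \<comment> \<open>Incomparable elements are distinct, so both can be split off from
      \<open>M\<close>.\<close>
    then have "y \<in># M - {#x#}" by (metis insert_DiffM insert_noteq_member order_refl)
    with xy obtain N where N: "M = add_mset x (add_mset y N)" by (metis insert_DiffM)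
    define z where "z = inf x y"
    have "z < x" "z < y"
      using xy by (metis z_def inf.cobounded1 inf.cobounded2 order_less_le)+
    then have z: "height z < height x" "height z < height y"
      by (simp_all add: height_less)
    \<comment> \<open>Each of the three monomials replaces \<open>x\<close>, \<open>y\<close> or
      both by the lower \<open>z\<close>: the weight drops, while the size stays that of
      \<open>M\<close>.\<close>
    obtain g1 where g1: "Poly_Mapping.keys g1 \<subseteq> {N \<in> standard_monomials. size N = size M}"
      "frag_of (add_mset z (add_mset x N)) - g1 \<in> relation_ideal"
      using less[of "add_mset z (add_mset x N)"] z by (auto simp: N weight_def)
    obtain g2 where g2: "Poly_Mapping.keys g2 \<subseteq> {N \<in> standard_monomials. size N = size M}"
      "frag_of (add_mset z (add_mset y N)) - g2 \<in> relation_ideal"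
      using less[of "add_mset z (add_mset y N)"] z by (auto simp: N weight_def)
    obtain g3 where g3: "Poly_Mapping.keys g3 \<subseteq> {N \<in> standard_monomials. size N = size M}"
      "frag_of (add_mset z (add_mset z N)) - g3 \<in> relation_ideal"
      using less[of "add_mset z (add_mset z N)"] z by (auto simp: N weight_def)
    have "frag_of N * ((hvar x - hvar z) * (hvar y - hvar z)) =
      frag_of M - frag_of (add_mset z (add_mset x N)) - frag_of (add_mset z (add_mset y N))
      + frag_of (add_mset z (add_mset z N))"
      by (simp add: hvar_def N algebra_simps mult_single add_mset_commute)
    moreover have "frag_of N * ((hvar x - hvar z) * (hvar y - hvar z)) \<in> relation_ideal"
      unfolding z_def by (intro relation_ideal_mult relation_in_ideal)
    ultimately have relation: "frag_of M - frag_of (add_mset z (add_mset x N)) -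
      frag_of (add_mset z (add_mset y N)) + frag_of (add_mset z (add_mset z N)) \<in> relation_ideal"
      by simp
    \<comment> \<open>Adding the first two congruences to the relation and subtracting the third
      cancels all three monomials containing \<open>z\<close>.\<close>
    have "frag_of M - (g1 + g2 - g3) \<in> relation_ideal"
      using relation_ideal_diff[OF relation_ideal_add[OF relation_ideal_add[OF relation g1(2)] g2(2)] g3(2)]
      by (simp add: algebra_simps)
    moreover have "Poly_Mapping.keys (g1 + g2 - g3) \<subseteq> {N \<in> standard_monomials. size N = size M}"
      using g1(1) g2(1) g3(1) keys_diff[of "g1 + g2" g3] Poly_Mapping.keys_add[of g1 g2] by blast
    ultimately show ?thesis by blast
  qed
qed

text \<open>The set \<open>T\<close> of allowed degrees serves two purposes: \<open>UNIV\<close>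
  gives spanning, and a singleton gives standard representatives inside one graded piece.\<close>

lemma standard_representative:
  fixes f :: "'a::{finite,semilattice_inf} int_mpoly"
  assumes "Poly_Mapping.keys f \<subseteq> {M. size M \<in> T}"
  obtains g where "Poly_Mapping.keys g \<subseteq> {M \<in> standard_monomials. size M \<in> T}"
    "f - g \<in> relation_ideal"
proof -
  have "\<exists>g. Poly_Mapping.keys g \<subseteq> {M \<in> standard_monomials. size M \<in> T} \<and> f - g \<in> relation_ideal"
    using assms
  proof (induction f rule: frag_induction)
    case zero
    then show ?case by (intro exI[of _ 0]) (simp add: relation_ideal_zero)
  next
    case (one M)
    obtain g where "Poly_Mapping.keys g \<subseteq> {N \<in> standard_monomials. size N = size M}"
      "frag_of M - g \<in> relation_ideal"
      using monomial_straightening[of M] by blast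
    with one show ?case by (intro exI[of _ g]) auto
  next
    case (diff a b)
    then obtain g h where "Poly_Mapping.keys g \<subseteq> {M \<in> standard_monomials. size M \<in> T}"
      "Poly_Mapping.keys h \<subseteq> {M \<in> standard_monomials. size M \<in> T}"
      "a - g \<in> relation_ideal" "b - h \<in> relation_ideal" by blast
    then show ?case
      using relation_ideal_diff[of "a - g" "b - h"] keys_diff[of g h]
      by (intro exI[of _ "g - h"]) (auto simp: algebra_simps)
  qed
  then show thesis using that by blast
qed

section \<open>The quotient algebra\<close>

lemma poly_class_eq_iff:
  fixes f g :: "'a::{finite,semilattice_inf} int_mpoly"
  shows "poly_class f = poly_class g \<longleftrightarrow> f - g \<in> relation_ideal"
proof -
  interpret ideal relation_ideal "int_mpoly_ring :: 'a int_mpoly ring" by (rule ideal_relation_ideal)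
  have "f \<ominus>\<^bsub>int_mpoly_ring\<^esub> g = f - g"
    by (simp add: a_minus_def)
  then show ?thesis
    unfolding poly_class_def
    using quotient_eq_iff_same_a_r_cos[OF ideal_relation_ideal, of f g] by simp
qed

text \<open>Independence in its working form: a difference of standard polynomials is standard, so
  an equation between their classes can be read coefficient by coefficient.\<close>

lemma poly_class_eq_iff_standard:
  assumes "Poly_Mapping.keys f \<subseteq> standard_monomials" "Poly_Mapping.keys g \<subseteq> standard_monomials"
  shows "poly_class f = poly_class g \<longleftrightarrow> f = g"
  using standard_in_relation_ideal[of "f - g"] keys_diff[of f g] assms
  by (auto simp: poly_class_eq_iff relation_ideal_zero)

lemma poly_class_standard:
  assumes "Poly_Mapping.keys f \<subseteq> {M. size M \<in> T}"
  obtains g where "Poly_Mapping.keys g \<subseteq> {M \<in> standard_monomials. size M \<in> T}"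
    "poly_class f = poly_class g"
  using standard_representative[OF assms] poly_class_eq_iff by metis

text \<open>All operations are computed on representatives, so that the algebra axioms reduce to
  identities between polynomials.\<close>

lemma semilattice_algebra_simps:
  fixes f g :: "'a::{finite,semilattice_inf} int_mpoly"
  shows "carrier semilattice_algebra = range (poly_class :: 'a int_mpoly \<Rightarrow> _)"
  "poly_class f \<otimes>\<^bsub>semilattice_algebra\<^esub> poly_class g = poly_class (f * g)"
  "poly_class f \<oplus>\<^bsub>semilattice_algebra\<^esub> poly_class g = poly_class (f + g)"
  "\<one>\<^bsub>semilattice_algebra\<^esub> = poly_class (1 :: 'a int_mpoly)"
  "\<zero>\<^bsub>semilattice_algebra\<^esub> = poly_class (0 :: 'a int_mpoly)"
  "k \<odot>\<^bsub>semilattice_algebra\<^esub> poly_class f = poly_class (frag_cmul k f)"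
proof -
  let ?Q = "int_mpoly_ring Quot (relation_ideal :: 'a int_mpoly set)"
  interpret ideal relation_ideal "int_mpoly_ring :: 'a int_mpoly ring" by (rule ideal_relation_ideal)
  interpret Q: ring ?Q by (rule quotient_is_ring)
  note hom = rcos_ring_hom[folded poly_class_def]
  have carrier: "carrier ?Q = range poly_class"
    by (auto simp: FactRing_def A_RCOSETS_def' poly_class_def)
  have mult: "poly_class f \<otimes>\<^bsub>?Q\<^esub> poly_class g = poly_class (f * g)" for f g :: "'a int_mpoly"
    using ring_hom_mult[OF hom, of f g] by (simp add: poly_class_def)
  have add: "poly_class f \<oplus>\<^bsub>?Q\<^esub> poly_class g = poly_class (f + g)" for f g :: "'a int_mpoly"
    using ring_hom_add[OF hom, of f g] by (simp add: poly_class_def)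
  have one: "\<one>\<^bsub>?Q\<^esub> = poly_class 1"
    using ring_hom_one[OF hom] by (simp add: poly_class_def)
  \<comment> \<open>The class of the zero polynomial is idempotent under addition, and in a group
    only the neutral element is.\<close>
  have zero: "\<zero>\<^bsub>?Q\<^esub> = poly_class 0"
    using Q.add.r_cancel_one'[of "poly_class 0" "poly_class 0"] carrier add[of 0 0] by auto
  have neg: "\<ominus>\<^bsub>?Q\<^esub> poly_class f = poly_class (- f)" for f :: "'a int_mpoly"
    by (rule Q.minus_equality) (auto simp: carrier add zero)
  have pow: "add_pow ?Q n (poly_class f) = poly_class (frag_cmul (int n) f)" for n :: nat and f :: "'a int_mpoly"
    by (induction n) (auto simp: add_pow_def nat_pow_def zero add frag_cmul_distrib add.commute)
  have smult: "add_pow ?Q k (poly_class f) = poly_class (frag_cmul k f)" for k :: int and f :: "'a int_mpoly"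
    by (cases "k \<ge> 0") (simp_all add: add_pow_int_ge add_pow_int_lt pow neg)
  note defs = semilattice_algebra_def int_algebra_of_def ring.defs
  show "carrier semilattice_algebra = range (poly_class :: 'a int_mpoly \<Rightarrow> _)" by (simp add: defs carrier)
  show "poly_class f \<otimes>\<^bsub>semilattice_algebra\<^esub> poly_class g = poly_class (f * g)" by (simp add: defs mult)
  show "poly_class f \<oplus>\<^bsub>semilattice_algebra\<^esub> poly_class g = poly_class (f + g)" by (simp add: defs add)
  show "\<one>\<^bsub>semilattice_algebra\<^esub> = poly_class (1 :: 'a int_mpoly)" by (simp add: defs one)
  show "\<zero>\<^bsub>semilattice_algebra\<^esub> = poly_class (0 :: 'a int_mpoly)" by (simp add: defs zero)
  show "k \<odot>\<^bsub>semilattice_algebra\<^esub> poly_class f = poly_class (frag_cmul k f)" by (simp add: defs smult)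
qed

lemma frag_cmul_mult:
  fixes f g :: "'a int_mpoly"
  shows "frag_cmul a f * g = frag_cmul a (f * g)"
proof -
  have frag_cmul_diff: "frag_cmul a (b - c) = frag_cmul a b - frag_cmul a c" for b c :: "'a int_mpoly"
    by (rule poly_mapping_eqI) (simp add: lookup_minus right_diff_distrib)
  \<comment> \<open>Scaling by \<open>a\<close> is multiplication by the constant polynomial
    \<open>a\<close>, whose monomial \<open>0\<close> is the empty multiset. The claim is then
    associativity.\<close>
  have "frag_cmul a h = Poly_Mapping.single 0 a * h" for h :: "'a int_mpoly"
  proof (induction h rule: frag_induction[OF subset_UNIV])
    case (2 M)
    show ?case by (rule poly_mapping_eqI) (simp add: mult_single lookup_single when_def)
  qed (simp_all add: frag_cmul_diff right_diff_distrib)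
  then show ?thesis by (simp add: mult.assoc)
qed

lemma algebra_semilattice_algebra: "algebra \<Z> semilattice_algebra"
proof (rule algebraI)
  show "cring semilattice_algebra"
  proof (rule cringI)
    show "abelian_group semilattice_algebra"
    proof (rule abelian_groupI)
      fix b assume "b \<in> carrier semilattice_algebra"
      then obtain f where "b = poly_class f" by (auto simp: semilattice_algebra_simps)
      then show "\<exists>a\<in>carrier semilattice_algebra. a \<oplus>\<^bsub>semilattice_algebra\<^esub> b = \<zero>\<^bsub>semilattice_algebra\<^esub>"
        by (auto simp: semilattice_algebra_simps intro!: exI[of _ "- f"])
    qed (auto simp: semilattice_algebra_simps algebra_simps)
    show "Group.comm_monoid semilattice_algebra"
      by (rule comm_monoidI) (auto simp: semilattice_algebra_simps algebra_simps)
  qed (auto simp: semilattice_algebra_simps algebra_simps)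
  show "(a \<odot>\<^bsub>semilattice_algebra\<^esub> x) \<otimes>\<^bsub>semilattice_algebra\<^esub> y =
      a \<odot>\<^bsub>semilattice_algebra\<^esub> (x \<otimes>\<^bsub>semilattice_algebra\<^esub> y)"
    if "x \<in> carrier semilattice_algebra" "y \<in> carrier semilattice_algebra" for a x y
  proof -
    from that obtain f g where "x = poly_class f" "y = poly_class g"
      by (auto simp: semilattice_algebra_simps)
    then show ?thesis by (simp add: semilattice_algebra_simps frag_cmul_mult)
  qed
qed (auto simp: semilattice_algebra_simps int_is_cring frag_cmul_distrib frag_cmul_distrib2)

lemma finsum_poly_class:
  "(\<Oplus>\<^bsub>semilattice_algebra\<^esub>i\<in>A. poly_class (f i)) = poly_class (\<Sum>i\<in>A. f i)"
proof -
  interpret algebra \<Z> semilattice_algebra by (rule algebra_semilattice_algebra)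
  show ?thesis
    by (induction A rule: infinite_finite_induct) (auto simp: semilattice_algebra_simps)
qed

lemma monomial_val_poly_class:
  fixes M :: "'a::{finite,semilattice_inf} multiset"
  shows "monomial_val semilattice_algebra (\<lambda>x. poly_class (hvar x)) M = poly_class (frag_of M)"
proof -
  interpret algebra \<Z> semilattice_algebra by (rule algebra_semilattice_algebra)
  have pow: "poly_class f [^]\<^bsub>semilattice_algebra\<^esub> n = poly_class (f ^ n)" for f and n :: nat
    by (induction n) (auto simp: semilattice_algebra_simps mult.commute)
  have prod: "(\<Otimes>\<^bsub>semilattice_algebra\<^esub>i\<in>A. poly_class (f i)) = poly_class (\<Prod>i\<in>A. f i)"
    for f :: "'a \<Rightarrow> 'a int_mpoly" and A
    by (induction A rule: infinite_finite_induct) (auto simp: semilattice_algebra_simps)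
  have "(\<Prod>y\<in>#M. hvar y) = frag_of M"
    by (induction M) (auto simp: hvar_def mult_single single_one[symmetric] simp del: single_one)
  then show ?thesis
    by (simp add: monomial_val_def pow prod flip: image_prod_mset_multiplicity)
qed

text \<open>A finitely supported coefficient family on monomials already is a polynomial, namely
  \<open>Abs_poly_mapping c\<close>, and the combination is its class.\<close>

lemma lin_comb_poly_class:
  assumes "finite {M. c M \<noteq> 0}"
  shows "lin_comb \<Z> semilattice_algebra (monomial_val semilattice_algebra (\<lambda>x. poly_class (hvar x))) c =
    poly_class (Abs_poly_mapping c)"
  using assms frag_expansion[of "Abs_poly_mapping c"]
  by (simp add: lin_comb_def monomial_val_poly_class semilattice_algebra_simps finsum_poly_class
      frag_extend_def keys.rep_eq)

section \<open>Homogeneous components and the grading\<close>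

lemma homogeneous_components:
  fixes f :: "'a int_mpoly"
  obtains h where "\<And>n. homogeneous_poly n (h n)" "\<And>n. n \<notin> size ` Poly_Mapping.keys f \<Longrightarrow> h n = 0"
    "f = (\<Sum>n\<in>size ` Poly_Mapping.keys f. h n)"
proof
  define h where "h n = (\<Sum>M | M \<in> Poly_Mapping.keys f \<and> size M = n.
    frag_cmul (Poly_Mapping.lookup f M) (frag_of M))" for n
  show "homogeneous_poly n (h n)" for n
    unfolding homogeneous_poly_def h_def
    using keys_sum[of "\<lambda>M. frag_cmul (Poly_Mapping.lookup f M) (frag_of M)"] by fastforce
  show "h n = 0" if "n \<notin> size ` Poly_Mapping.keys f" for n
    unfolding h_def by (rule sum.neutral) (use that in auto)
  have "f = (\<Sum>M\<in>Poly_Mapping.keys f. frag_cmul (Poly_Mapping.lookup f M) (frag_of M))"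
    by (subst frag_expansion) (simp only: frag_extend_def)
  also have "\<dots> = (\<Sum>n\<in>size ` Poly_Mapping.keys f. h n)"
    unfolding h_def by (rule sum.image_gen) simp
  finally show "f = (\<Sum>n\<in>size ` Poly_Mapping.keys f. h n)" .
qed

text \<open>Polynomials of different degrees share no monomial, so only the summand of index
  \<open>size M\<close> contributes. If this index lies outside \<open>A\<close>, both sides are
  zero.\<close>

lemma lookup_sum_homogeneous:
  assumes "finite A" "\<And>n. homogeneous_poly n (g n)" "\<And>n. n \<notin> A \<Longrightarrow> g n = 0"
  shows "Poly_Mapping.lookup (\<Sum>n\<in>A. g n) M = Poly_Mapping.lookup (g (size M)) M"
proof -
  have "Poly_Mapping.lookup (g n) M = 0" if "n \<noteq> size M" for n
    using assms(2)[of n] that by (auto simp: homogeneous_poly_def in_keys_iff)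
  then have "Poly_Mapping.lookup (g n) M =
    (if n = size M then Poly_Mapping.lookup (g (size M)) M else 0)" for n
    by simp
  then have "Poly_Mapping.lookup (\<Sum>n\<in>A. g n) M =
    (\<Sum>n\<in>A. if n = size M then Poly_Mapping.lookup (g (size M)) M else 0)"
    unfolding lookup_sum by (intro sum.cong) auto
  then show ?thesis using assms(1,3) by simp
qed

lemma semilattice_grade_standard:
  assumes "b \<in> semilattice_grade n"
  obtains g where "homogeneous_poly n g" "Poly_Mapping.keys g \<subseteq> standard_monomials" "b = poly_class g"
proof -
  from assms obtain f where f: "Poly_Mapping.keys f \<subseteq> {M. size M \<in> {n}}" "b = poly_class f"
    by (auto simp: semilattice_grade_def homogeneous_poly_def)
  show thesis
    by (rule poly_class_standard[OF f(1)]) (rule that, auto simp: homogeneous_poly_def f(2))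
qed

text \<open>With standard homogeneous representatives in every degree, both sums are classes of
  standard polynomials. These polynomials are equal, and equal polynomials have equal
  components.\<close>

lemma semilattice_grade_decomposition_unique:
  fixes F F' :: "nat \<Rightarrow> 'a::{finite,semilattice_inf} int_mpoly set"
  assumes F: "\<And>n. F n \<in> semilattice_grade n" "finite {n. F n \<noteq> \<zero>\<^bsub>semilattice_algebra\<^esub>}"
    and F': "\<And>n. F' n \<in> semilattice_grade n" "finite {n. F' n \<noteq> \<zero>\<^bsub>semilattice_algebra\<^esub>}"
    and eq: "(\<Oplus>\<^bsub>semilattice_algebra\<^esub>n\<in>{n. F n \<noteq> \<zero>\<^bsub>semilattice_algebra\<^esub>}. F n) =
      (\<Oplus>\<^bsub>semilattice_algebra\<^esub>n\<in>{n. F' n \<noteq> \<zero>\<^bsub>semilattice_algebra\<^esub>}. F' n)"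
  shows "F = F'"
proof -
  have rep: "\<exists>g. (\<forall>n. homogeneous_poly n (g n) \<and> Poly_Mapping.keys (g n) \<subseteq> standard_monomials \<and>
      G n = poly_class (g n))"
    if "\<And>n. G n \<in> semilattice_grade n" for G :: "nat \<Rightarrow> 'a int_mpoly set"
  proof -
    have "\<exists>g. homogeneous_poly n g \<and> Poly_Mapping.keys g \<subseteq> standard_monomials \<and> G n = poly_class g" for n
      by (rule semilattice_grade_standard[OF that[of n]]) blast
    then show ?thesis by metis
  qed
  obtain g where g: "\<And>n. homogeneous_poly n (g n)"
    "\<And>n. Poly_Mapping.keys (g n) \<subseteq> standard_monomials" "\<And>n. F n = poly_class (g n)"
    using rep[OF F(1)] by metis
  obtain g' where g': "\<And>n. homogeneous_poly n (g' n)"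
    "\<And>n. Poly_Mapping.keys (g' n) \<subseteq> standard_monomials" "\<And>n. F' n = poly_class (g' n)"
    using rep[OF F'(1)] by metis
  define A where "A = {n. F n \<noteq> \<zero>\<^bsub>semilattice_algebra\<^esub>}"
  define A' where "A' = {n. F' n \<noteq> \<zero>\<^bsub>semilattice_algebra\<^esub>}"
  \<comment> \<open>A vanishing class has the zero polynomial as its only standard representative,
    so the representatives have the same finite support as the classes.\<close>
  have A: "n \<notin> A \<Longrightarrow> g n = 0" for n
    using poly_class_eq_iff_standard[OF g(2)[of n], of 0] by (simp add: A_def g(3) semilattice_algebra_simps)
  have A': "n \<notin> A' \<Longrightarrow> g' n = 0" for n
    using poly_class_eq_iff_standard[OF g'(2)[of n], of 0] by (simp add: A'_def g'(3) semilattice_algebra_simps)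
  have keys: "Poly_Mapping.keys (\<Sum>n\<in>A. g n) \<subseteq> standard_monomials"
    "Poly_Mapping.keys (\<Sum>n\<in>A'. g' n) \<subseteq> standard_monomials"
    using keys_sum[of g A] keys_sum[of g' A'] g(2) g'(2) by blast+
  have "poly_class (\<Sum>n\<in>A. g n) = poly_class (\<Sum>n\<in>A'. g' n)"
    using eq unfolding A_def[symmetric] A'_def[symmetric] by (simp add: g(3) g'(3) finsum_poly_class)
  then have sum_eq: "(\<Sum>n\<in>A. g n) = (\<Sum>n\<in>A'. g' n)"
    using poly_class_eq_iff_standard[OF keys] by simp
  have fin: "finite A" "finite A'" using F(2) F'(2) by (simp_all add: A_def A'_def)
  have "g n = g' n" for n
  proof (rule poly_mapping_eqI)
    fix M
    show "Poly_Mapping.lookup (g n) M = Poly_Mapping.lookup (g' n) M"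
    proof (cases "size M = n")
      case True
      then show ?thesis
        using lookup_sum_homogeneous[OF fin(1) g(1) A, of M]
          lookup_sum_homogeneous[OF fin(2) g'(1) A', of M] sum_eq by simp
    next
      case False
      then have "M \<notin> Poly_Mapping.keys (g n)" "M \<notin> Poly_Mapping.keys (g' n)"
        using g(1)[of n] g'(1)[of n] by (auto simp: homogeneous_poly_def)
      then show ?thesis by (simp add: in_keys_iff)
    qed
  qed
  then show ?thesis by (simp add: fun_eq_iff g(3) g'(3))
qed

lemma graded_algebra_semilattice_algebra: "graded_algebra \<Z> semilattice_algebra semilattice_grade"
proof -
  interpret algebra \<Z> "semilattice_algebra :: (int, 'a int_mpoly set) module"
    by (rule algebra_semilattice_algebra)
  have neg: "\<ominus>\<^bsub>semilattice_algebra\<^esub> poly_class f = poly_class (- f)" for f :: "'a int_mpoly"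
    by (rule M.minus_equality) (auto simp: semilattice_algebra_simps)
  show ?thesis
  proof (intro graded_algebra.intro algebra_semilattice_algebra graded_algebra_axioms.intro)
    fix n
    show "submodule (semilattice_grade n) \<Z> (semilattice_algebra :: (int, 'a int_mpoly set) module)"
    proof (rule submoduleI)
      fix a b :: "'a int_mpoly set" assume "a \<in> semilattice_grade n" "b \<in> semilattice_grade n"
      then obtain f g where "a = poly_class f" "b = poly_class g" "homogeneous_poly n f" "homogeneous_poly n g"
        by (auto simp: semilattice_grade_def)
      then show "a \<oplus>\<^bsub>semilattice_algebra\<^esub> b \<in> semilattice_grade n"
        using Poly_Mapping.keys_add[of f g]
        by (auto simp: semilattice_algebra_simps semilattice_grade_def homogeneous_poly_def intro!: imageI)
    qed (auto simp: semilattice_grade_def semilattice_algebra_simps homogeneous_poly_def neg intro!: imageI)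
  next
    fix b :: "'a int_mpoly set" assume "b \<in> carrier semilattice_algebra"
    then obtain f where f: "b = poly_class f" by (auto simp: semilattice_algebra_simps)
    obtain h where h: "\<And>n. homogeneous_poly n (h n)"
      "\<And>n. n \<notin> size ` Poly_Mapping.keys f \<Longrightarrow> h n = 0" "f = (\<Sum>n\<in>size ` Poly_Mapping.keys f. h n)"
      using homogeneous_components[of f] by metis
    define F where "F n = poly_class (h n)" for n
    let ?A = "{n. F n \<noteq> \<zero>\<^bsub>semilattice_algebra\<^esub>}"
    \<comment> \<open>Only an inclusion is available, as a nonzero component of \<open>f\<close> may
      have class zero. Such degrees contribute nothing to the sum and are dropped.\<close>
    have sub: "?A \<subseteq> size ` Poly_Mapping.keys f"
      using h(2) by (auto simp: F_def semilattice_algebra_simps)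
    have "b = (\<Oplus>\<^bsub>semilattice_algebra\<^esub>n\<in>size ` Poly_Mapping.keys f. F n)"
      using h(3) by (simp add: f F_def finsum_poly_class)
    also have "\<dots> = (\<Oplus>\<^bsub>semilattice_algebra\<^esub>n\<in>?A. F n)"
      by (rule M.add.finprod_mono_neutral_cong_right)
        (use sub in \<open>auto simp: F_def semilattice_algebra_simps\<close>)
    finally have b: "b = (\<Oplus>\<^bsub>semilattice_algebra\<^esub>n\<in>?A. F n)" .
    show "\<exists>!f. (\<forall>n. f n \<in> semilattice_grade n) \<and> finite {n. f n \<noteq> \<zero>\<^bsub>semilattice_algebra\<^esub>} \<and>
        b = (\<Oplus>\<^bsub>semilattice_algebra\<^esub>n\<in>{n. f n \<noteq> \<zero>\<^bsub>semilattice_algebra\<^esub>}. f n)"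
    proof (rule ex1I[of _ F])
      show F: "(\<forall>n. F n \<in> semilattice_grade n) \<and> finite ?A \<and> b = (\<Oplus>\<^bsub>semilattice_algebra\<^esub>n\<in>?A. F n)"
        using b h(1) finite_subset[OF sub] by (auto simp: F_def semilattice_grade_def)
      show "G = F" if "(\<forall>n. G n \<in> semilattice_grade n) \<and>
          finite {n. G n \<noteq> \<zero>\<^bsub>semilattice_algebra\<^esub>} \<and>
          b = (\<Oplus>\<^bsub>semilattice_algebra\<^esub>n\<in>{n. G n \<noteq> \<zero>\<^bsub>semilattice_algebra\<^esub>}. G n)" for G
        by (rule semilattice_grade_decomposition_unique) (use that F in auto)
    qed
  next
    show "\<one>\<^bsub>semilattice_algebra\<^esub> \<in> semilattice_grade 0"
      by (auto simp: semilattice_algebra_simps semilattice_grade_def homogeneous_poly_def intro!: imageI)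
  next
    fix a b :: "'a int_mpoly set" and i j
    assume "a \<in> semilattice_grade i" "b \<in> semilattice_grade j"
    then obtain f g where "a = poly_class f" "b = poly_class g" "homogeneous_poly i f" "homogeneous_poly j g"
      by (auto simp: semilattice_grade_def)
    then show "a \<otimes>\<^bsub>semilattice_algebra\<^esub> b \<in> semilattice_grade (i + j)"
      using Poly_Mapping.keys_mult[of f g]
      by (fastforce simp: semilattice_algebra_simps semilattice_grade_def homogeneous_poly_def intro!: imageI)
  qed
qed

section \<open>The standard basis and the straightening law\<close>

lemma standard_monomials_is_basis:
  "is_basis \<Z> semilattice_algebra
    (monomial_val semilattice_algebra (\<lambda>x::'a::{finite,semilattice_inf}. poly_class (hvar x)))
    standard_monomials"
  unfolding is_basis_def
proof (intro conjI ballI impI)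
  let ?v = "monomial_val semilattice_algebra (\<lambda>x::'a. poly_class (hvar x))"
  show "?v M \<in> carrier semilattice_algebra" for M
    by (simp add: monomial_val_poly_class semilattice_algebra_simps)
  show "c M = \<zero>\<^bsub>\<Z>\<^esub>"
    if "c \<in> coeffs_on \<Z> standard_monomials" "lin_comb \<Z> semilattice_algebra ?v c = \<zero>\<^bsub>semilattice_algebra\<^esub>"
    for c M
  proof -
    have fin: "finite {M. c M \<noteq> 0}" and "{M. c M \<noteq> 0} \<subseteq> standard_monomials"
      using that(1) by (auto simp: coeffs_on_def)
    then have "Abs_poly_mapping c = 0"
      using that(2) poly_class_eq_iff_standard[of "Abs_poly_mapping c" 0]
      by (simp add: lin_comb_poly_class semilattice_algebra_simps keys.rep_eq)
    then have "c = Poly_Mapping.lookup 0"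
      using lookup_Abs_poly_mapping[of c] fin by simp
    then show ?thesis by simp
  qed
  fix b :: "'a int_mpoly set" assume "b \<in> carrier semilattice_algebra"
  then obtain f where "b = poly_class f" by (auto simp: semilattice_algebra_simps)
  then obtain g where g: "Poly_Mapping.keys g \<subseteq> standard_monomials" "b = poly_class g"
    using poly_class_standard[of f UNIV] by auto
  show "\<exists>c\<in>coeffs_on \<Z> standard_monomials. b = lin_comb \<Z> semilattice_algebra ?v c"
  proof
    show "Poly_Mapping.lookup g \<in> coeffs_on \<Z> standard_monomials"
      using g(1) by (auto simp: coeffs_on_def in_keys_iff subset_iff)
    show "b = lin_comb \<Z> semilattice_algebra ?v (Poly_Mapping.lookup g)"
      by (simp add: lin_comb_poly_class g(2) lookup_inverse)
  qed
qed

theorem theorem4p2: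
  shows "algebra_with_straightening_law \<Z>
           (semilattice_algebra :: (int, 'a::{finite,semilattice_inf} int_mpoly set) module)
           semilattice_grade
           (\<lambda>x::'a. poly_class (hvar x))"
proof (intro algebra_with_straightening_law.intro graded_algebra_semilattice_algebra
    algebra_with_straightening_law_axioms.intro standard_monomials_is_basis)
  have empty: "{#} \<in> standard_monomials" and single: "\<And>x::'a. {#x#} \<in> standard_monomials"
    by (auto simp: standard_monomials_def)
  show "bij_betw (\<lambda>r. r \<odot>\<^bsub>semilattice_algebra\<^esub> \<one>\<^bsub>semilattice_algebra\<^esub>) (carrier \<Z>)
      (semilattice_grade 0 :: 'a int_mpoly set set)"
  proof (rule bij_betw_imageI)
    show "inj_on (\<lambda>r. r \<odot>\<^bsub>semilattice_algebra\<^esub> (\<one>\<^bsub>semilattice_algebra\<^esub> :: 'a int_mpoly set)) (carrier \<Z>)"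
    proof (rule inj_onI)
      fix r s
      assume "r \<odot>\<^bsub>semilattice_algebra\<^esub> (\<one>\<^bsub>semilattice_algebra\<^esub> :: 'a int_mpoly set) =
        s \<odot>\<^bsub>semilattice_algebra\<^esub> \<one>\<^bsub>semilattice_algebra\<^esub>"
      then have "poly_class (frag_cmul r 1 :: 'a int_mpoly) = poly_class (frag_cmul s 1)"
        by (simp add: semilattice_algebra_simps)
      moreover have "Poly_Mapping.keys (frag_cmul t 1 :: 'a int_mpoly) \<subseteq> standard_monomials" for t
        using empty keys_cmul[of t "1 :: 'a int_mpoly"] by auto
      ultimately have "frag_cmul r 1 = (frag_cmul s 1 :: 'a int_mpoly)"
        by (simp add: poly_class_eq_iff_standard)
      \<comment> \<open>The coefficient at the empty monomial recovers the scalar.\<close>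
      from arg_cong[OF this, of "\<lambda>f. Poly_Mapping.lookup f 0"] show "r = s" by simp
    qed
    have "poly_class f \<in> range (\<lambda>r. r \<odot>\<^bsub>semilattice_algebra\<^esub> \<one>\<^bsub>semilattice_algebra\<^esub>)"
      if "homogeneous_poly 0 f" for f :: "'a int_mpoly"
    proof -
      \<comment> \<open>The only monomial of size zero is \<open>{#}\<close>, so \<open>f\<close> is
        constant.\<close>
      have "f = frag_cmul (Poly_Mapping.lookup f {#}) 1"
        using that by (intro poly_mapping_eqI) (auto simp: homogeneous_poly_def in_keys_iff lookup_one when_def)
      then have "poly_class f = Poly_Mapping.lookup f {#} \<odot>\<^bsub>semilattice_algebra\<^esub> \<one>\<^bsub>semilattice_algebra\<^esub>"
        unfolding semilattice_algebra_simps by (rule arg_cong)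
      then show ?thesis by (rule range_eqI)
    qed
    then show "(\<lambda>r. r \<odot>\<^bsub>semilattice_algebra\<^esub> \<one>\<^bsub>semilattice_algebra\<^esub>) ` carrier \<Z> =
        (semilattice_grade 0 :: 'a int_mpoly set set)"
      using keys_cmul[of _ "1 :: 'a int_mpoly"]
      by (fastforce simp: semilattice_grade_def semilattice_algebra_simps homogeneous_poly_def)
  qed
  show "inj (\<lambda>x::'a. poly_class (hvar x))"
    by (rule injI) (use single in \<open>simp add: poly_class_eq_iff_standard hvar_def frag_of_eq\<close>)
  show "\<exists>n>0. poly_class (hvar x) \<in> semilattice_grade n" for x :: 'a
    by (rule exI[of _ 1]) (auto simp: semilattice_grade_def homogeneous_poly_def hvar_def)
next
  fix x y :: 'a and c M
  assume incomparable: "\<not> x \<le> y" "\<not> y \<le> x" and c: "c \<in> coeffs_on \<Z> standard_monomials"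
    and xy: "poly_class (hvar x) \<otimes>\<^bsub>semilattice_algebra\<^esub> poly_class (hvar y) =
      lin_comb \<Z> semilattice_algebra (monomial_val semilattice_algebra (\<lambda>x. poly_class (hvar x))) c"
    and M: "c M \<noteq> \<zero>\<^bsub>\<Z>\<^esub>"
  define z where "z = inf x y"
  have z: "z < x" "z < y"
    using incomparable by (metis z_def inf.cobounded1 inf.cobounded2 order_less_le)+
  \<comment> \<open>This is the product of \<open>hvar x\<close> and \<open>hvar y\<close> rewritten
    by the defining relation. All its monomials are standard and contain \<open>z\<close>.\<close>
  define p where "p = frag_of {#z, x#} + frag_of {#z, y#} - frag_of {#z, z#}"
  have keys_p: "Poly_Mapping.keys p \<subseteq> {{#z, x#}, {#z, y#}, {#z, z#}}"
    unfolding p_def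
    using keys_diff[of "frag_of {#z, x#} + frag_of {#z, y#}" "frag_of {#z, z#}"]
      Poly_Mapping.keys_add[of "frag_of {#z, x#}" "frag_of {#z, y#}"] by auto
  have "hvar x * hvar y - p = (hvar x - hvar z) * (hvar y - hvar z)"
    by (simp add: p_def hvar_def algebra_simps mult_single add_mset_commute)
  then have "poly_class (hvar x * hvar y) = poly_class p"
    using relation_in_ideal[of x y] by (simp add: poly_class_eq_iff z_def)
  moreover have fin: "finite {M. c M \<noteq> 0}" and std: "{M. c M \<noteq> 0} \<subseteq> standard_monomials"
    using c by (auto simp: coeffs_on_def)
  ultimately have "poly_class (Abs_poly_mapping c) = poly_class p"
    using xy by (simp add: lin_comb_poly_class semilattice_algebra_simps)
  moreover have "Poly_Mapping.keys p \<subseteq> standard_monomials"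
    by (rule order_trans[OF keys_p]) (use z in \<open>auto simp: standard_monomials_def\<close>)
  \<comment> \<open>The given expansion \<open>c\<close> is arbitrary; uniqueness of standard
    representatives identifies it with the explicit one.\<close>
  ultimately have "Abs_poly_mapping c = p"
    using fin std by (simp add: poly_class_eq_iff_standard keys.rep_eq)
  then have "M \<in> Poly_Mapping.keys p"
    using fin M by (auto simp: keys.rep_eq)
  then have "z \<in># M" using keys_p by auto
  with z show "\<exists>z. z \<in># M \<and> z < x \<and> z < y" by blast
qed

end
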